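(* Let $p$ be a prime, $q=p^e>4$, and let $\ell$ be a positive integer with $2\ell\mid e$. Let $\boldsymbol a=(a_1,\ldots,a_n)$ be a vector of pairwise distinct elements of $\mathbb F_q$ and put $u_i=\prod_{1\le j\le n,\,j\ne i}(a_i-a_j)^{-1}$. Let $\delta\in\mathbb Z_{>0}$ and $\lambda\in\mathbb F_q^{*}$. Assume that $\lambda a_i^{\delta-1}u_i\in\mathbb F_{p^\ell}^{*}$ for $1\le i\le n$. Let $s\ge1$ and let $A_s\in\operatorname{GL}_s(\mathbb F_q)$ be arbitrary. Then, for every integer $k$ with $s<k\le\left\lfloor\frac{n+p^\ell-\delta}{p^\ell+1}\right\rfloor$ and every integer $h$ with $0\le h\le k-s$, there exists an $[n+s,k]_q$ generalized Roth-Lempel code $C$ with extension matrix $A_s$ such that $\dim(\operatorname{Hull}_{\ell}(C))=h$.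
   Context: For $q=p^e$ and $0\le\ell\le e-1$, the $\ell$-Galois inner product on $\mathbb F_q^N$ is $\langle\boldsymbol x,\boldsymbol y\rangle_\ell=\sum_i x_iy_i^{p^\ell}$. For a linear code $C\subseteq\mathbb F_q^N$, $C^{\perp_\ell}=\{\boldsymbol x\in\mathbb F_q^N:\langle\boldsymbol c,\boldsymbol x\rangle_\ell=0\ \text{for all }\boldsymbol c\in C\}$ and $\operatorname{Hull}_\ell(C)=C\cap C^{\perp_\ell}$. Generalized Roth-Lempel (GRL) code: let $1\le s\le k\le n$, let $\boldsymbol a\in\mathbb F_q^n$ have pairwise distinct entries, let $\boldsymbol v\in(\mathbb F_q^* )^n$ and $A_s\in\operatorname{GL}_s(\mathbb F_q)$. Then $\operatorname{GRL}_k(\boldsymbol a,\boldsymbol v,A_s)$ is the $[n+s,k]_q$ linear code $$\{(v_1f(a_1),\ldots,v_nf(a_n),(f_{k-s},\ldots,f_{k-1})A_s): f(x)=\textstyle\sum_{j=0}^{k-1}f_jx^j\in\mathbb F_q[x]\}.$$ The matrix $A_s$ is called its extension matrix. An $[N,k]_q$ code is a $k$-dimensional subspace of $\mathbb F_q^N$. Convention: $x^0=1$, including $0^0=1$. *)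

theory Defs
  imports
    "Jordan_Normal_Form.VS_Connect"
    "HOL-Algebra.Subrings"
begin

text \<open>
  The field with \<open>q = p ^ e\<close> elements is a type of class \<open>{finite, field}\<close> of cardinality
  \<open>p ^ e\<close>, and \<open>class_ring\<close> is that type viewed as a ring record. Vectors are indexed from 0,
  so the entry written \<open>a_i\<close> on paper is \<open>a $ (i - 1)\<close>.
\<close>

definition galois_inner :: "nat \<Rightarrow> nat \<Rightarrow> 'a :: field vec \<Rightarrow> 'a vec \<Rightarrow> 'a" where
  "galois_inner p l x y = (\<Sum>i<dim_vec y. x $ i * (y $ i) ^ (p ^ l))"

definition galois_dual :: "nat \<Rightarrow> nat \<Rightarrow> nat \<Rightarrow> 'a :: field vec set \<Rightarrow> 'a vec set" where
  "galois_dual p l N C = {x \<in> carrier_vec N. \<forall>c\<in>C. galois_inner p l c x = 0}"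

definition galois_hull :: "nat \<Rightarrow> nat \<Rightarrow> nat \<Rightarrow> 'a :: field vec set \<Rightarrow> 'a vec set" where
  "galois_hull p l N C = C \<inter> galois_dual p l N C"

text \<open>Meaningful only when \<open>W\<close> is a linear subspace of the space of vectors of length \<open>N\<close>.\<close>

definition vdim :: "nat \<Rightarrow> 'a :: field vec set \<Rightarrow> nat" where
  "vdim N W = vectorspace.dim class_ring ((module_vec TYPE('a) N)\<lparr>carrier := W\<rparr>)"

definition linear_code :: "nat \<Rightarrow> nat \<Rightarrow> 'a :: field vec set \<Rightarrow> bool" where
  "linear_code N k C \<longleftrightarrow>
     VectorSpace.subspace class_ring C (module_vec TYPE('a) N) \<and> vdim N C = k"

definition general_linear :: "nat \<Rightarrow> 'a :: field mat set" where
  "general_linear s = {A \<in> carrier_mat s s. invertible_mat A}"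

text \<open>
  For \<open>k \<ge> 1\<close> the condition \<open>degree f < k\<close> includes the zero polynomial, whose degree is 0.
  The row vector times matrix product \<open>w A\<close> is written as \<open>A\<^sup>T w\<close>.
\<close>

definition GRL :: "nat \<Rightarrow> 'a :: field vec \<Rightarrow> 'a vec \<Rightarrow> 'a mat \<Rightarrow> 'a vec set" where
  "GRL k a v A =
     {vec (dim_vec a) (\<lambda>i. v $ i * poly f (a $ i)) @\<^sub>v
      (transpose_mat A *\<^sub>v vec (dim_row A) (\<lambda>j. Polynomial.coeff f (k - dim_row A + j)))
      | f. Polynomial.degree f < k}"

definition is_GRL_code :: "nat \<Rightarrow> nat \<Rightarrow> nat \<Rightarrow> 'a :: field mat \<Rightarrow> 'a vec set \<Rightarrow> bool" where
  "is_GRL_code n s k A C \<longleftrightarrow>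
     1 \<le> s \<and> s \<le> k \<and> k \<le> n \<and> A \<in> general_linear s \<and>
     (\<exists>a v. a \<in> carrier_vec n \<and> inj_on (($) a) {..<n} \<and>
            v \<in> carrier_vec n \<and> (\<forall>i<n. v $ i \<noteq> 0) \<and>
            C = GRL k a v A)"

end

theory Submission
  imports Defs
begin

text \<open>
  Write \<open>P = p ^ l\<close>. The map \<open>x \<mapsto> x ^ (P + 1)\<close> reaches every element of the unit group of
  the field of order \<open>P\<close>, because \<open>P\<^sup>2 - 1\<close> divides \<open>q - 1\<close>; so column multipliers with
  \<open>v_i ^ (P + 1) = \<lambda> a_i ^ (\<delta> - 1) u_i\<close> exist. For these, the evaluation part of the
  inner product of two codewords is a sum \<open>\<Sum>u_i F(a_i)\<close> with \<open>deg F \<le> n - 2\<close>, which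
  vanishes by Lagrange interpolation, so the hull consists of the words of the polynomials whose
  top \<open>s\<close> coefficients are zero and has dimension \<open>k - s\<close>. Since \<open>q > 4\<close> there is
  \<open>b \<noteq> 0\<close> with \<open>b ^ (P + 1) \<noteq> 1\<close>. Multiplying \<open>v_i\<close> by \<open>b\<close> at
  \<open>k - s - h\<close> positions forces the polynomials in the hull to vanish at the corresponding
  points \<open>a_i\<close> too, which lowers the dimension to \<open>h\<close>.
\<close>

section \<open>Linear images and bounded-degree polynomials\<close>

text \<open>An injective map has zero kernel, so rank-nullity makes its image have full dimension
  \<open>m\<close>. The code and its hull are both recognised as linear codes in this way, as
  injective linear images of coordinate spaces.\<close>

lemma linear_code_image:
  fixes T :: "'a :: field vec \<Rightarrow> 'a vec"
  assumes "\<And>x. x \<in> carrier_vec m \<Longrightarrow> T x \<in> carrier_vec N"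
    and "\<And>x y. x \<in> carrier_vec m \<Longrightarrow> y \<in> carrier_vec m \<Longrightarrow> T (x + y) = T x + T y"
    and "\<And>c x. x \<in> carrier_vec m \<Longrightarrow> T (c \<cdot>\<^sub>v x) = c \<cdot>\<^sub>v T x"
    and "inj_on T (carrier_vec m)"
  shows "linear_code N m (T ` carrier_vec m)"
proof -
  interpret V: vec_space "TYPE('a)" m .
  interpret W: vec_space "TYPE('a)" N .
  interpret linear_map class_ring "module_vec TYPE('a) m" "module_vec TYPE('a) N" T
    using vec_vs vec_vs
    by (intro linear_map.intro mod_hom.intro mod_hom_axioms.intro vec_module)
      (auto simp: LinearCombinations.module_hom_def module_vec_simps assms(1-3))
  have im: "imT = T ` carrier_vec m"
    by (simp add: im_def module_vec_simps)
  have "vectorspace.dim class_ring (W.vs imT) = m"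
    using rank_nullity V.fin_dim inj_imp_dim_ker0 assms(4) V.dim_is_n
    by (simp add: module_vec_simps)
  then show ?thesis
    using imT_is_subspace unfolding linear_code_def vdim_def im by simp
qed

text \<open>The bound is put on the coefficients rather than on the degree so that
  \<open>polys_below 0\<close> contains only the zero polynomial. The case \<open>h = 0\<close> then
  needs no separate treatment.\<close>

definition polys_below :: "nat \<Rightarrow> 'a :: zero poly set" where
  "polys_below m = {f. \<forall>i\<ge>m. Polynomial.coeff f i = 0}"

lemma polys_below_conv_degree:
  "m > 0 \<Longrightarrow> polys_below m = {f. Polynomial.degree f < m}"
  unfolding polys_below_def
  by (auto simp: coeff_eq_0 intro: degree_lessI) 

lemma polys_below_degree: "f \<in> polys_below m \<Longrightarrow> f \<noteq> 0 \<Longrightarrow> Polynomial.degree f < m"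
  unfolding polys_below_def using leading_coeff_0_iff not_less by blast

lemma diff_mem_polys_below:
  fixes f g :: "'a :: ab_group_add poly"
  shows "f \<in> polys_below m \<Longrightarrow> g \<in> polys_below m \<Longrightarrow> f - g \<in> polys_below m"
  by (simp add: polys_below_def)

text \<open>This identifies the coordinate space of dimension \<open>m\<close> with
  \<open>polys_below m\<close>, so that \<open>linear_code_image\<close>, which speaks of vectors
  only, applies to spaces of polynomials.\<close>

definition poly_of_vector :: "'a :: comm_monoid_add vec \<Rightarrow> 'a poly" where
  "poly_of_vector c = (\<Sum>j<dim_vec c. Polynomial.monom (c $ j) j)"

lemma coeff_poly_of_vector:
  "Polynomial.coeff (poly_of_vector c) i = (if i < dim_vec c then c $ i else 0)"
  by (simp add: poly_of_vector_def coeff_sum)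

lemma poly_of_vector_add:
  "x \<in> carrier_vec m \<Longrightarrow> y \<in> carrier_vec m \<Longrightarrow>
    poly_of_vector (x + y) = poly_of_vector x + poly_of_vector y"
  by (auto simp: poly_eq_iff coeff_poly_of_vector)

lemma poly_of_vector_smult:
  "poly_of_vector (c \<cdot>\<^sub>v x) = Polynomial.smult c (poly_of_vector x)"
  by (auto simp: poly_eq_iff coeff_poly_of_vector)

lemma inj_on_poly_of_vector: "inj_on poly_of_vector (carrier_vec m)"
proof (rule inj_onI)
  fix x y :: "'a vec"
  assume xy: "x \<in> carrier_vec m" "y \<in> carrier_vec m" and eq: "poly_of_vector x = poly_of_vector y"
  show "x = y"
  proof (rule eq_vecI)
    fix i assume "i < dim_vec y"
    then show "x $ i = y $ i"
      using arg_cong[OF eq, of "\<lambda>f. Polynomial.coeff f i"] xy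
      by (simp add: coeff_poly_of_vector)
  qed (use xy in auto)
qed

lemma poly_of_vector_image: "poly_of_vector ` carrier_vec m = polys_below m"
proof (intro equalityI subsetI)
  fix f :: "'a poly" assume f: "f \<in> polys_below m"
  then have "f = poly_of_vector (vec m (Polynomial.coeff f))"
    by (auto simp: poly_eq_iff coeff_poly_of_vector polys_below_def)
  then show "f \<in> poly_of_vector ` carrier_vec m" by auto
qed (auto simp: polys_below_def coeff_poly_of_vector)

section \<open>Polynomial interpolation\<close>

lemma poly_eq_0_if_many_roots:
  fixes f :: "'a :: idom poly"
  assumes "f \<in> polys_below (card S)" and "inj_on x S" and "\<And>i. i \<in> S \<Longrightarrow> poly f (x i) = 0"
  shows "f = 0"
proof (rule ccontr)
  assume nz: "f \<noteq> 0"
  have "card S = card (x ` S)" using assms(2) by (simp add: card_image)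
  also have "\<dots> \<le> card {z. poly f z = 0}"
    using assms(3) poly_roots_finite[OF nz] by (intro card_mono) auto
  also have "\<dots> \<le> Polynomial.degree f" using card_poly_roots_bound[OF nz] .
  finally show False using polys_below_degree[OF assms(1) nz] by simp
qed

lemma prod_linear_monic:
  fixes x :: "'b \<Rightarrow> 'a :: idom"
  assumes "finite S"
  shows "Polynomial.degree (\<Prod>i\<in>S. [:- x i, 1:]) = card S"
    and "Polynomial.coeff (\<Prod>i\<in>S. [:- x i, 1:]) (card S) = 1"
proof -
  show *: "Polynomial.degree (\<Prod>i\<in>S. [:- x i, 1:]) = card S"
    by (subst degree_prod_eq_sum_degree) auto
  have "lead_coeff (\<Prod>i\<in>S. [:- x i, 1:]) = 1" by (simp add: lead_coeff_prod)
  then show "Polynomial.coeff (\<Prod>i\<in>S. [:- x i, 1:]) (card S) = 1" unfolding * .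
qed

text \<open>Each product of linear factors is monic of degree \<open>card S - 1\<close>, so the
  coefficient of \<open>L\<close> in that degree is the sum of the scalar factors. This coefficient
  is the link between the weights \<open>u\<close> and interpolation.\<close>

lemma lagrange_interpolation:
  fixes x y :: "'b \<Rightarrow> 'a :: field"
  assumes "finite S" and "inj_on x S"
  defines "u \<equiv> \<lambda>i. \<Prod>j\<in>S - {i}. inverse (x i - x j)"
  defines "L \<equiv> \<Sum>i\<in>S. Polynomial.smult (y i * u i) (\<Prod>j\<in>S - {i}. [:- x j, 1:])"
  shows "L \<in> polys_below (card S)"
    and "i \<in> S \<Longrightarrow> poly L (x i) = y i"
    and "S \<noteq> {} \<Longrightarrow> Polynomial.coeff L (card S - 1) = (\<Sum>i\<in>S. u i * y i)"
proof -
  have card: "card (S - {i}) = card S - 1" "card S > 0" if "i \<in> S" for i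
    using that assms(1) card_gt_0_iff by auto
  have deg: "Polynomial.degree (\<Prod>j\<in>S - {i}. [:- x j, 1:]) = card S - 1"
    and lc: "Polynomial.coeff (\<Prod>j\<in>S - {i}. [:- x j, 1:]) (card S - 1) = 1" if "i \<in> S" for i
    using prod_linear_monic[of "S - {i}" x] card[OF that] assms(1) by auto
  show "L \<in> polys_below (card S)"
    unfolding polys_below_def L_def mem_Collect_eq coeff_sum coeff_smult
  proof (intro allI impI sum.neutral ballI)
    fix m i assume "card S \<le> m" "i \<in> S"
    then have "Polynomial.degree (\<Prod>j\<in>S - {i}. [:- x j, 1:]) < m"
      using deg[of i] card(2)[of i] by linarith
    then show "y i * u i * Polynomial.coeff (\<Prod>j\<in>S - {i}. [:- x j, 1:]) m = 0"
      by (simp add: coeff_eq_0)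
  qed
  show "Polynomial.coeff L (card S - 1) = (\<Sum>i\<in>S. u i * y i)" if "S \<noteq> {}"
    by (simp add: L_def coeff_sum lc[simplified] mult.commute)
  show "poly L (x i) = y i" if i: "i \<in> S"
  proof -
    have "poly L (x i) = (\<Sum>m\<in>S. y m * u m * (\<Prod>j\<in>S - {m}. x i - x j))"
      by (simp add: L_def poly_sum poly_prod)
    also have "\<dots> = (\<Sum>m\<in>S. if m = i then y i else 0)"
    proof (rule sum.cong[OF refl])
      fix m assume m: "m \<in> S"
      show "y m * u m * (\<Prod>j\<in>S - {m}. x i - x j) = (if m = i then y i else 0)"
      proof (cases "m = i")
        case True
        have "u i * (\<Prod>j\<in>S - {i}. x i - x j) = (\<Prod>j\<in>S - {i}. inverse (x i - x j) * (x i - x j))"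
          by (simp add: u_def prod.distrib)
        also have "\<dots> = 1"
        proof (intro prod.neutral ballI)
          fix j assume "j \<in> S - {i}"
          then have "x i - x j \<noteq> 0" using assms(2) i by (auto dest: inj_onD)
          then show "inverse (x i - x j) * (x i - x j) = 1" by (rule left_inverse)
        qed
        finally show ?thesis using True by (simp add: mult.assoc)
      next
        case False
        then have "(\<Prod>j\<in>S - {m}. x i - x j) = 0"
          using i assms(1) by (intro prod_zero) auto
        then show ?thesis using False by simp
      qed
    qed
    also have "\<dots> = y i" using i assms(1) by simp
    finally show ?thesis .
  qed
qed

text \<open>A polynomial in \<open>polys_below (card S)\<close> is its own interpolant, since the
  two agree at \<open>card S\<close> points. The weighted sum is therefore the coefficient of
  \<open>f\<close> in degree \<open>card S - 1\<close>, which the hypothesis on \<open>f\<close>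
  makes zero.\<close>

lemma sum_lagrange_weights_eq_0:
  fixes x :: "'b \<Rightarrow> 'a :: field"
  assumes "finite S" and "inj_on x S" and "S \<noteq> {}" and "f \<in> polys_below (card S - 1)"
  shows "(\<Sum>i\<in>S. (\<Prod>j\<in>S - {i}. inverse (x i - x j)) * poly f (x i)) = 0"
proof -
  define L where "L = (\<Sum>i\<in>S. Polynomial.smult (poly f (x i) * (\<Prod>j\<in>S - {i}. inverse (x i - x j)))
    (\<Prod>j\<in>S - {i}. [:- x j, 1:]))"
  note L = lagrange_interpolation[OF assms(1,2), where y = "\<lambda>i. poly f (x i)", folded L_def]
  have "f \<in> polys_below (card S)" using assms(4) by (simp add: polys_below_def)
  then have "f - L = 0"
    using L(1,2) by (intro poly_eq_0_if_many_roots[OF _ assms(2)] diff_mem_polys_below) auto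
  moreover have "Polynomial.coeff f (card S - 1) = 0" using assms(4) by (simp add: polys_below_def)
  ultimately show ?thesis using L(3)[OF assms(3)] by simp
qed

text \<open>Division by the monic product leaves a remainder with \<open>card S\<close> roots and
  too small a degree, hence zero, and the degree of the quotient drops by \<open>card S\<close>. The
  dimension \<open>h\<close> of the hull is read off from the right-hand side.\<close>

lemma polys_vanishing_on:
  fixes x :: "'b \<Rightarrow> 'a :: field"
  assumes "finite S" and "inj_on x S"
  shows "{f \<in> polys_below (card S + h). \<forall>i\<in>S. poly f (x i) = 0} =
    (*) (\<Prod>i\<in>S. [:- x i, 1:]) ` polys_below h"
proof (intro equalityI subsetI)
  let ?p = "\<Prod>i\<in>S. [:- x i, 1:]"
  note p = prod_linear_monic[OF assms(1), of x]
  have nz: "?p \<noteq> 0" using assms(1) by simp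
  {
    fix f assume "f \<in> {f \<in> polys_below (card S + h). \<forall>i\<in>S. poly f (x i) = 0}"
    then have f: "f \<in> polys_below (card S + h)" "\<And>i. i \<in> S \<Longrightarrow> poly f (x i) = 0" by auto
    have "poly ?p (x i) = 0" if "i \<in> S" for i
      unfolding poly_prod using that assms(1) by (intro prod_zero bexI[of _ i]) auto
    then have "poly (f mod ?p) (x i) = 0" if "i \<in> S" for i
      using that f(2) arg_cong[OF mult_div_mod_eq[of ?p f], of "\<lambda>g. poly g (x i)"]
      unfolding poly_add poly_mult by simp
    moreover have "f mod ?p \<in> polys_below (card S)"
      using degree_mod_less[OF nz, of f] p(1) by (auto simp: polys_below_def coeff_eq_0)
    ultimately have "f mod ?p = 0"
      by (intro poly_eq_0_if_many_roots[OF _ assms(2)]) auto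
    then obtain g where g: "f = ?p * g" by (meson dvdE mod_0_imp_dvd)
    have "g \<in> polys_below h"
    proof (cases "g = 0")
      case False
      have "f \<noteq> 0" using False nz unfolding g by simp
      moreover have "Polynomial.degree f = card S + Polynomial.degree g"
        unfolding g degree_mult_eq[OF nz False] p(1) ..
      ultimately have "Polynomial.degree g < h" using polys_below_degree[OF f(1)] by simp
      then show ?thesis by (auto simp: polys_below_def coeff_eq_0)
    qed (simp add: polys_below_def)
    then show "f \<in> (*) ?p ` polys_below h" using g by blast
  next
    fix f assume "f \<in> (*) ?p ` polys_below h"
    then obtain g where g: "g \<in> polys_below h" "f = ?p * g" by auto
    have "f \<in> polys_below (card S + h)"
    proof (cases "g = 0")
      case False
      then have "Polynomial.degree f < card S + h"
        using degree_mult_eq[OF nz False] polys_below_degree[OF g(1) False] g(2) p(1) by simp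
      then show ?thesis by (auto simp: polys_below_def coeff_eq_0)
    qed (simp add: polys_below_def g)
    moreover have "poly f (x i) = 0" if "i \<in> S" for i
      unfolding g poly_mult poly_prod using that assms(1)
      by (subst prod_zero) (auto intro: bexI[of _ i])
    ultimately show "f \<in> {f \<in> polys_below (card S + h). \<forall>i\<in>S. poly f (x i) = 0}" by simp
  }
qed

text \<open>The monomials in \<open>top\<close> fix the coefficients from \<open>r\<close> on. The
  values on \<open>S\<close> are then corrected by an interpolant from
  \<open>polys_below (card S)\<close>, which leaves those coefficients alone because
  \<open>card S \<le> r\<close>.\<close>

lemma interpolation_with_top_coeffs:
  fixes x y :: "'b \<Rightarrow> 'a :: field"
  assumes "finite S" and "inj_on x S" and "card S \<le> r"
  obtains g where "g \<in> polys_below (r + s)" and "\<And>i. i \<in> S \<Longrightarrow> poly g (x i) = y i"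
    and "\<And>j. j < s \<Longrightarrow> Polynomial.coeff g (r + j) = t j"
proof -
  define top where "top = (\<Sum>j<s. Polynomial.monom (t j) (r + j))"
  obtain g where g: "g \<in> polys_below (card S)"
    "\<And>i. i \<in> S \<Longrightarrow> poly g (x i) = y i - poly top (x i)"
    using lagrange_interpolation(1,2)[OF assms(1,2), where y = "\<lambda>i. y i - poly top (x i)"] by blast
  have top: "Polynomial.coeff top i = (\<Sum>j<s. if r + j = i then t j else 0)" for i
    by (simp add: top_def coeff_sum)
  have "Polynomial.coeff top (r + j) = t j" if "j < s" for j
    using that by (simp add: top)
  moreover have "top \<in> polys_below (r + s)"
    by (auto simp: polys_below_def top intro!: sum.neutral)
  moreover have "Polynomial.coeff g i = 0" if "i \<ge> r" for i
    using g(1) assms(3) that by (simp add: polys_below_def)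
  ultimately show ?thesis
    using g by (intro that[of "g + top"]) (auto simp: polys_below_def)
qed

section \<open>Roots in finite fields\<close>

text \<open>Multiplication by \<open>x\<close> is injective on the finite set \<open>G\<close>,
  hence permutes it. Comparing the product of all elements before and after leaves the factor
  \<open>x ^ card G\<close>.\<close>

lemma power_card_eq_1:
  fixes G :: "'a :: field set"
  assumes "finite G" and "0 \<notin> G" and "\<And>x y. x \<in> G \<Longrightarrow> y \<in> G \<Longrightarrow> x * y \<in> G" and "x \<in> G"
  shows "x ^ card G = 1"
proof -
  have inj: "inj_on ((*) x) G"
    using assms(2,4) by (auto intro!: inj_onI)
  moreover have "(*) x ` G \<subseteq> G" using assms(3,4) by auto
  ultimately have "(*) x ` G = G" using assms(1) by (intro endo_inj_surj)
  then have "\<Prod>G = (\<Prod>y\<in>G. x * y)"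
    using prod.reindex[OF inj, of id] by simp
  also have "\<dots> = x ^ card G * \<Prod>G" by (simp add: prod.distrib)
  finally show ?thesis using assms(1,2) by simp
qed

lemma card_nth_roots_le:
  fixes y :: "'a :: field"
  assumes "m > 0"
  shows "finite {x. x ^ m = y}" and "card {x. x ^ m = y} \<le> m"
proof -
  let ?f = "Polynomial.monom 1 m + [:- y:]"
  have deg: "Polynomial.degree ?f = m"
    using assms by (subst degree_add_eq_left) (auto simp: degree_monom_eq)
  then have nz: "?f \<noteq> 0" using assms by auto
  have eq: "{x. x ^ m = y} = {x. poly ?f x = 0}" by (auto simp: poly_monom)
  show "finite {x. x ^ m = y}" unfolding eq by (rule poly_roots_finite[OF nz])
  show "card {x. x ^ m = y} \<le> m"
    using card_poly_roots_bound[OF nz] unfolding eq deg .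
qed

text \<open>Let \<open>t\<close> be the number of units divided by \<open>card G\<close>. The
  \<open>t\<close>-th power map sends the units into \<open>G\<close>, and counting shows that it is
  onto \<open>G\<close>. Since \<open>r\<close> divides \<open>t\<close>, every element of
  \<open>G\<close> is an \<open>r\<close>-th power.\<close>

lemma exists_nth_root_finite_field:
  fixes G :: "'a :: {finite, field} set"
  assumes G: "0 \<notin> G" "\<And>x y. x \<in> G \<Longrightarrow> y \<in> G \<Longrightarrow> x * y \<in> G" and "w \<in> G"
    and dvd: "card G * r dvd card (UNIV :: 'a set) - 1"
  shows "\<exists>x. x ^ r = w"
proof -
  let ?U = "UNIV - {0 :: 'a}"
  have U: "card ?U = card (UNIV :: 'a set) - 1" by simp
  obtain c where c: "card ?U = card G * r * c" using dvd unfolding U by (elim dvdE)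
  define t where "t = r * c"
  have m: "card ?U = card G * t" by (simp add: c t_def)
  have "1 \<in> ?U" by simp
  then have "card ?U > 0" using card_gt_0_iff finite by blast
  then have pos: "card G > 0" "t > 0" by (simp_all add: m)
  \<comment> \<open>The equation \<open>y ^ card G = 1\<close> has at most \<open>card G\<close>
    solutions, so \<open>G\<close> contains all of them and membership in \<open>G\<close> becomes
    an equation.\<close>
  have "G \<subseteq> {y. y ^ card G = 1}" using power_card_eq_1[OF _ G] by auto
  then have GR: "{y. y ^ card G = 1} = G"
    using card_nth_roots_le[OF pos(1), of 1] by (intro card_seteq[symmetric]) auto
  have sub: "(\<lambda>x. x ^ t) ` ?U \<subseteq> G"
  proof (intro image_subsetI)
    fix x assume "x \<in> ?U"
    then have "x ^ card ?U = 1" by (intro power_card_eq_1) auto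
    then have "(x ^ t) ^ card G = 1" by (metis m mult.commute power_mult)
    then show "x ^ t \<in> G" using GR by blast
  qed
  \<comment> \<open>Each fibre of the power map has at most \<open>t\<close> elements, so the
    \<open>card G * t\<close> units have at least \<open>card G\<close> images.\<close>
  have "card ?U \<le> card ((\<lambda>x. x ^ t) ` ?U) * t"
  proof -
    have "?U \<subseteq> (\<Union>y\<in>(\<lambda>x. x ^ t) ` ?U. {x. x ^ t = y})" by auto
    then have "card ?U \<le> card (\<Union>y\<in>(\<lambda>x. x ^ t) ` ?U. {x. x ^ t = y})"
      by (intro card_mono) auto
    also have "\<dots> \<le> (\<Sum>y\<in>(\<lambda>x. x ^ t) ` ?U. card {x. x ^ t = y})"
      by (intro card_UN_le) auto
    also have "\<dots> \<le> card ((\<lambda>x. x ^ t) ` ?U) * t"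
      using sum_bounded_above[of "(\<lambda>x. x ^ t) ` ?U" "\<lambda>y. card {x. x ^ t = y}" t,
          OF card_nth_roots_le(2)[OF pos(2)]] by simp
    finally show ?thesis .
  qed
  then have "card G \<le> card ((\<lambda>x. x ^ t) ` ?U)" using pos(2) by (simp add: m)
  then have "(\<lambda>x. x ^ t) ` ?U = G" using sub by (intro card_seteq) auto
  then obtain x where "x ^ t = w" using \<open>w \<in> G\<close> by blast
  then have "(x ^ c) ^ r = w" by (metis t_def mult.commute power_mult)
  then show ?thesis by blast
qed

text \<open>At most \<open>m\<close> elements are \<open>m\<close>-th roots of unity, while there
  are more than \<open>m\<close> nonzero elements.\<close>

lemma exists_non_root_of_unity:
  assumes "m > 0" and "card (UNIV :: 'a set) > m + 1"
  obtains b :: "'a :: {finite, field}" where "b \<noteq> 0" and "b ^ m \<noteq> 1"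
proof -
  have "card {x :: 'a. x ^ m = 1} < card (UNIV - {0 :: 'a})"
    using card_nth_roots_le(2)[OF assms(1), of "1 :: 'a"] assms(2) by simp
  then have "\<not> UNIV - {0 :: 'a} \<subseteq> {x. x ^ m = 1}"
    using card_mono[OF finite, of "UNIV - {0 :: 'a}" "{x. x ^ m = 1}"] by linarith
  then show ?thesis using that by auto
qed

text \<open>With \<open>P\<^sup>2\<close> for \<open>x\<close> this yields that
  \<open>P\<^sup>2 - 1\<close> divides \<open>p ^ e - 1\<close>. Truncated subtraction does no harm:
  for \<open>x = 0\<close> the right-hand side is 0.\<close>

lemma minus_one_dvd_power_minus_one: "x - 1 dvd x ^ m - (1 :: nat)"
proof (induction m)
  case (Suc m)
  show ?case
  proof (cases "x = 0")
    case False
    then have "x ^ m \<ge> 1" by simp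
    then have "x ^ Suc m - 1 = x * (x ^ m - 1) + (x - 1)"
      using False by (simp add: diff_mult_distrib2)
    then show ?thesis using Suc by simp
  qed simp
qed simp

section \<open>Generalized Roth-Lempel codes\<close>

text \<open>The encoding map as a function of the polynomial, so that the hull can be written as the
  image of a set of polynomials.\<close>

definition grl_word :: "nat \<Rightarrow> 'a :: field vec \<Rightarrow> 'a vec \<Rightarrow> 'a mat \<Rightarrow> 'a poly \<Rightarrow> 'a vec" where
  "grl_word k a v A f =
     vec (dim_vec a) (\<lambda>i. v $ i * poly f (a $ i)) @\<^sub>v
     (transpose_mat A *\<^sub>v vec (dim_row A) (\<lambda>j. Polynomial.coeff f (k - dim_row A + j)))"

lemma GRL_conv_grl_word: "k > 0 \<Longrightarrow> GRL k a v A = grl_word k a v A ` polys_below k"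
  unfolding GRL_def grl_word_def polys_below_conv_degree by auto

lemma grl_word_carrier:
  "a \<in> carrier_vec n \<Longrightarrow> A \<in> carrier_mat s s \<Longrightarrow> grl_word k a v A f \<in> carrier_vec (n + s)"
  unfolding grl_word_def by auto

lemma grl_word_index:
  assumes "a \<in> carrier_vec n" and "A \<in> carrier_mat s s"
  shows "i < n \<Longrightarrow> grl_word k a v A f $ i = v $ i * poly f (a $ i)"
    and "j < s \<Longrightarrow> grl_word k a v A f $ (n + j) =
      (transpose_mat A *\<^sub>v vec s (\<lambda>j. Polynomial.coeff f (k - s + j))) $ j"
  using assms unfolding grl_word_def by auto

lemma grl_word_add:
  assumes "a \<in> carrier_vec n" and "A \<in> carrier_mat s s"
  shows "grl_word k a v A (f + g) = grl_word k a v A f + grl_word k a v A g"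
proof -
  let ?c = "\<lambda>f. vec s (\<lambda>j. Polynomial.coeff f (k - s + j))"
  have "?c (f + g) = ?c f + ?c g" by auto
  moreover have "transpose_mat A *\<^sub>v (?c f + ?c g) = transpose_mat A *\<^sub>v ?c f + transpose_mat A *\<^sub>v ?c g"
    using assms(2) by (intro mult_add_distrib_mat_vec[where nr = s and nc = s]) auto
  moreover have "vec n (\<lambda>i. v $ i * poly (f + g) (a $ i)) =
      vec n (\<lambda>i. v $ i * poly f (a $ i)) + vec n (\<lambda>i. v $ i * poly g (a $ i))"
    by (auto simp: distrib_left)
  moreover have "dim_vec a = n" "dim_row A = s" using assms by auto
  ultimately show ?thesis
    using assms(2) unfolding grl_word_def
    by (simp only:) (rule append_vec_add[symmetric, where n = n and m = s], auto)
qed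

lemma grl_word_smult:
  assumes "a \<in> carrier_vec n" and "A \<in> carrier_mat s s"
  shows "grl_word k a v A (Polynomial.smult c f) = c \<cdot>\<^sub>v grl_word k a v A f"
proof -
  have "vec s (\<lambda>j. Polynomial.coeff (Polynomial.smult c f) (k - s + j)) =
      c \<cdot>\<^sub>v vec s (\<lambda>j. Polynomial.coeff f (k - s + j))" by auto
  moreover have "transpose_mat A *\<^sub>v (c \<cdot>\<^sub>v vec s (\<lambda>j. Polynomial.coeff f (k - s + j))) =
      c \<cdot>\<^sub>v (transpose_mat A *\<^sub>v vec s (\<lambda>j. Polynomial.coeff f (k - s + j)))"
    using assms(2) by (intro mult_mat_vec[where nr = s and nc = s]) auto
  moreover have "dim_vec a = n" "dim_row A = s" using assms by auto
  ultimately show ?thesis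
    using assms(2) unfolding grl_word_def by (simp only:) (intro eq_vecI, auto simp: append_vec_def Let_def)
qed

text \<open>The first \<open>n\<close> coordinates already determine the polynomial: the multipliers
  are nonzero, and a difference in \<open>polys_below n\<close> with \<open>n\<close> distinct roots
  is zero.\<close>

lemma inj_on_grl_word:
  assumes "a \<in> carrier_vec n" and "A \<in> carrier_mat s s" and "inj_on (($) a) {..<n}"
    and "\<And>i. i < n \<Longrightarrow> v $ i \<noteq> 0" and "k \<le> n"
  shows "inj_on (grl_word k a v A) (polys_below k)"
proof (rule inj_onI)
  fix f g assume fg: "f \<in> polys_below k" "g \<in> polys_below k"
    and eq: "grl_word k a v A f = grl_word k a v A g"
  have "poly (f - g) (a $ i) = 0" if "i \<in> {..<n}" for i
    using arg_cong[OF eq, of "\<lambda>x. x $ i"] that assms(4)[of i]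
    by (simp add: grl_word_index[OF assms(1,2)])
  moreover have "f - g \<in> polys_below (card {..<n})"
    using fg assms(5) by (simp add: polys_below_def)
  ultimately have "f - g = 0" by (intro poly_eq_0_if_many_roots[OF _ assms(3)])
  then show "f = g" by simp
qed

text \<open>The factor \<open>q\<close> lets one statement serve twice: \<open>q = 1\<close> gives
  the whole code, and the product of the linear factors at the points indexed by \<open>S\<close>
  gives the hull.\<close>

lemma linear_code_grl_word:
  assumes "a \<in> carrier_vec n" and "A \<in> carrier_mat s s" and "inj_on (($) a) {..<n}"
    and "\<And>i. i < n \<Longrightarrow> v $ i \<noteq> 0" and "k \<le> n"
    and "q \<noteq> 0" and sub: "(*) q ` polys_below m \<subseteq> polys_below k"
  shows "linear_code (n + s) m (grl_word k a v A ` (*) q ` polys_below m)"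
proof -
  have "linear_code (n + s) m ((\<lambda>c. grl_word k a v A (q * poly_of_vector c)) ` carrier_vec m)"
  proof (rule linear_code_image)
    show "inj_on (\<lambda>c. grl_word k a v A (q * poly_of_vector c)) (carrier_vec m)"
    proof (rule inj_onI)
      fix x y :: "'a vec" assume xy: "x \<in> carrier_vec m" "y \<in> carrier_vec m"
        and eq: "grl_word k a v A (q * poly_of_vector x) = grl_word k a v A (q * poly_of_vector y)"
      have "q * poly_of_vector c \<in> polys_below k" if "c \<in> carrier_vec m" for c
        using sub that poly_of_vector_image by blast
      then have "q * poly_of_vector x = q * poly_of_vector y"
        using inj_onD[OF inj_on_grl_word[OF assms(1-5)] eq] xy by blast
      then have "poly_of_vector x = poly_of_vector y" using \<open>q \<noteq> 0\<close> by simp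
      then show "x = y" using xy inj_onD[OF inj_on_poly_of_vector] by blast
    qed
  qed (simp_all add: grl_word_carrier[OF assms(1,2)] grl_word_add[OF assms(1,2)] distrib_left
      grl_word_smult[OF assms(1,2)] poly_of_vector_add poly_of_vector_smult)
  then show ?thesis by (simp add: image_image flip: poly_of_vector_image[of m])
qed

section \<open>Galois inner products of codewords\<close>

lemma galois_inner_grl_word:
  assumes a: "a \<in> carrier_vec n" and A: "A \<in> carrier_mat s s"
  shows "galois_inner p l (grl_word k a v A g) (grl_word k a v A f) =
    (\<Sum>i<n. (v $ i) ^ (p ^ l + 1) * (poly g (a $ i) * poly f (a $ i) ^ (p ^ l))) +
    galois_inner p l (transpose_mat A *\<^sub>v vec s (\<lambda>j. Polynomial.coeff g (k - s + j)))
      (transpose_mat A *\<^sub>v vec s (\<lambda>j. Polynomial.coeff f (k - s + j)))"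
proof -
  have split: "(\<Sum>i<n + s. F i) = (\<Sum>i<n. F i) + (\<Sum>j<s. F (n + j))" for F :: "nat \<Rightarrow> 'a"
    by (induction s) (simp_all add: ac_simps)
  have "dim_vec (grl_word k a v A f) = n + s"
    using grl_word_carrier[OF a A] by auto
  \<comment> \<open>The word of \<open>g\<close> contributes one factor \<open>v $ i\<close> and the
    word of \<open>f\<close> contributes \<open>p ^ l\<close> of them, whence the exponent
    \<open>p ^ l + 1\<close>.\<close>
  moreover have "(\<Sum>i<n. grl_word k a v A g $ i * (grl_word k a v A f $ i) ^ (p ^ l)) =
      (\<Sum>i<n. (v $ i) ^ (p ^ l + 1) * (poly g (a $ i) * poly f (a $ i) ^ (p ^ l)))"
    by (intro sum.cong refl) (simp add: grl_word_index(1)[OF a A] power_mult_distrib)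
  moreover have "dim_vec (transpose_mat A *\<^sub>v vec s (\<lambda>j. Polynomial.coeff f (k - s + j))) = s"
    using A by simp
  ultimately show ?thesis
    unfolding galois_inner_def by (simp add: split grl_word_index(2)[OF a A] del: index_mult_mat_vec)
qed

text \<open>The polynomial \<open>F\<close> has degree at most
  \<open>(\<delta> - 1) + (k - 1) * (P + 1)\<close>. The numerical hypothesis says that this is at
  most \<open>n - 2\<close>, the range in which the Lagrange weights annihilate evaluations.\<close>

lemma sum_lagrange_weights_mult_eq_0:
  fixes a :: "'a :: field vec"
  assumes "inj_on (($) a) {..<n}" and "\<delta> > 0" and "k > 0"
    and "f \<in> polys_below k" and "g \<in> polys_below k" and "k * (P + 1) + \<delta> \<le> n + P"
  shows "(\<Sum>i<n. c * (a $ i) ^ (\<delta> - 1) * (\<Prod>j\<in>{..<n} - {i}. inverse (a $ i - a $ j)) *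
    (poly g (a $ i) * poly f (a $ i) ^ P)) = 0"
proof -
  define F where "F = Polynomial.monom 1 (\<delta> - 1) * (g * f ^ P)"
  have fg: "Polynomial.degree f \<le> k - 1" "Polynomial.degree g \<le> k - 1"
    using assms(3-5) by (auto simp: polys_below_conv_degree)
  have "Polynomial.degree F \<le> (\<delta> - 1) + (Polynomial.degree g + Polynomial.degree f * P)"
    unfolding F_def
    by (intro order.trans[OF degree_mult_le] add_mono degree_power_le degree_monom_le order.refl)
  also have "\<dots> \<le> (\<delta> - 1) + ((k - 1) + (k - 1) * P)"
    using fg by (intro add_mono mult_right_mono) auto
  also have "\<dots> < n - 1"
  proof -
    obtain k' where k': "k = Suc k'" using assms(3) gr0_conv_Suc by auto
    show ?thesis using assms(2,6) unfolding k' by (simp add: algebra_simps)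
  qed
  finally have deg: "Polynomial.degree F < n - 1" .
  then have "F \<in> polys_below (card {..<n} - 1)" by (auto simp: polys_below_def coeff_eq_0)
  moreover have "{..<n} \<noteq> {}" using deg by (auto simp: lessThan_empty_iff)
  ultimately have "(\<Sum>i<n. (\<Prod>j\<in>{..<n} - {i}. inverse (a $ i - a $ j)) * poly F (a $ i)) = 0"
    by (intro sum_lagrange_weights_eq_0[OF _ assms(1)]) auto
  then have "c * (\<Sum>i<n. (\<Prod>j\<in>{..<n} - {i}. inverse (a $ i - a $ j)) * poly F (a $ i)) = 0"
    by simp
  then show ?thesis
    by (simp add: F_def poly_monom sum_distrib_left ac_simps)
qed

lemma galois_inner_zero_right:
  assumes "p > 0" shows "galois_inner p l x (0\<^sub>v n) = 0"
  using assms by (simp add: galois_inner_def power_0_left)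

lemma galois_inner_zero_left:
  "y \<in> carrier_vec n \<Longrightarrow> galois_inner p l (0\<^sub>v n) y = 0"
  by (auto simp: galois_inner_def)

lemma galois_inner_unit_vec_left:
  assumes "y \<in> carrier_vec n" and "j < n"
  shows "galois_inner p l (unit_vec n j) y = (y $ j) ^ (p ^ l)"
proof -
  have "galois_inner p l (unit_vec n j) y = (\<Sum>i<n. if i = j then (y $ i) ^ (p ^ l) else 0)"
    unfolding galois_inner_def by (rule sum.cong) (use assms in auto)
  then show ?thesis using assms(2) by simp
qed

text \<open>The extension coordinates are \<open>transpose_mat A\<close> applied to the top
  coefficients. The first identity makes every extension vector attainable; the second shows that a
  zero extension vector comes only from zero top coefficients.\<close>

lemma general_linear_transpose_inverse:
  assumes "A \<in> general_linear s"
  obtains B where "B \<in> carrier_mat s s" and "transpose_mat A * B = 1\<^sub>m s"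
    and "B * transpose_mat A = 1\<^sub>m s"
proof -
  obtain B where A: "A \<in> carrier_mat s s" and B: "inverts_mat A B" "inverts_mat B A"
    using assms unfolding general_linear_def invertible_mat_def by blast
  have 1: "A * B = 1\<^sub>m s" "B * A = 1\<^sub>m (dim_row B)"
    using A B by (simp_all add: inverts_mat_def)
  have "B \<in> carrier_mat s s"
    using arg_cong[OF 1(1), of dim_col] arg_cong[OF 1(2), of dim_col] A by auto
  moreover from this have "transpose_mat A * transpose_mat B = 1\<^sub>m s"
    "transpose_mat B * transpose_mat A = 1\<^sub>m s"
    using A 1 by (simp_all flip: transpose_mult)
  ultimately show ?thesis using that[of "transpose_mat B"] by simp
qed

text \<open>Only the coordinates in \<open>S\<close> and the extension coordinates contribute to the inner product
  of two words, and interpolation prescribes these contributions independently.\<close>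

lemma galois_hull_grl_word:
  fixes a v :: "'a :: field vec"
  assumes a: "a \<in> carrier_vec n" and inj: "inj_on (($) a) {..<n}" and A: "A \<in> general_linear s"
    and S: "S \<subseteq> {..<n}" and k: "k = card S + h + s" and "p > 0"
    and w: "\<And>i. i < n \<Longrightarrow> w i \<noteq> 0" and "\<beta> \<noteq> 1"
    and v: "\<And>i. i < n \<Longrightarrow> (v $ i) ^ (p ^ l + 1) = (if i \<in> S then \<beta> * w i else w i)"
    and orth: "\<And>f g. f \<in> polys_below k \<Longrightarrow> g \<in> polys_below k \<Longrightarrow>
      (\<Sum>i<n. w i * (poly g (a $ i) * poly f (a $ i) ^ (p ^ l))) = 0"
  shows "galois_hull p l (n + s) (grl_word k a v A ` polys_below k) =
    grl_word k a v A ` {f \<in> polys_below (card S + h). \<forall>i\<in>S. poly f (a $ i) = 0}"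
proof -
  have fin: "finite S" using S finite_subset by blast
  have injS: "inj_on (($) a) S" using inj S inj_on_subset by blast
  have Ac: "A \<in> carrier_mat s s" using A by (simp add: general_linear_def)
  obtain B where B: "B \<in> carrier_mat s s" "transpose_mat A * B = 1\<^sub>m s" "B * transpose_mat A = 1\<^sub>m s"
    using general_linear_transpose_inverse[OF A] .
  have ks: "k - s = card S + h" using k by simp
  let ?top = "\<lambda>f. vec s (\<lambda>j. Polynomial.coeff f (k - s + j))"
  let ?ext = "\<lambda>f. transpose_mat A *\<^sub>v ?top f"
  let ?W = "grl_word k a v A"
  have ext: "?ext f \<in> carrier_vec s" for f using Ac by simp
  \<comment> \<open>By \<open>orth\<close> the sum with weights \<open>w i\<close> over all
    positions vanishes. Only the excess \<open>(\<beta> - 1) * w i\<close> at the positions in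
    \<open>S\<close> and the extension part survive.\<close>
  have inner: "galois_inner p l (?W g) (?W f) =
      (\<Sum>i\<in>S. (\<beta> - 1) * w i * (poly g (a $ i) * poly f (a $ i) ^ (p ^ l))) +
      galois_inner p l (?ext g) (?ext f)"
    if "f \<in> polys_below k" "g \<in> polys_below k" for f g
  proof -
    let ?c = "\<lambda>i. poly g (a $ i) * poly f (a $ i) ^ (p ^ l)"
    have "(\<Sum>i<n. (v $ i) ^ (p ^ l + 1) * ?c i) =
        (\<Sum>i<n. w i * ?c i + (if i \<in> S then (\<beta> - 1) * w i * ?c i else 0))"
      by (intro sum.cong refl, subst v) (auto simp: algebra_simps)
    also have "\<dots> = (\<Sum>i\<in>S. (\<beta> - 1) * w i * ?c i)"
      using S by (simp add: sum.distrib orth[OF that] sum.inter_restrict[symmetric] Int_absorb1)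
    finally show ?thesis unfolding galois_inner_grl_word[OF a Ac] by simp
  qed
  have hull: "galois_hull p l (n + s) (?W ` polys_below k) =
      ?W ` {f \<in> polys_below k. \<forall>g\<in>polys_below k. galois_inner p l (?W g) (?W f) = 0}"
    using grl_word_carrier[OF a Ac] unfolding galois_hull_def galois_dual_def by auto
  have "{f \<in> polys_below k. \<forall>g\<in>polys_below k. galois_inner p l (?W g) (?W f) = 0} =
      {f \<in> polys_below (card S + h). \<forall>i\<in>S. poly f (a $ i) = 0}"
  proof (intro equalityI subsetI)
    fix f assume "f \<in> {f \<in> polys_below (card S + h). \<forall>i\<in>S. poly f (a $ i) = 0}"
    then have f: "f \<in> polys_below (card S + h)" "\<And>i. i \<in> S \<Longrightarrow> poly f (a $ i) = 0" by auto
    have fk: "f \<in> polys_below k" using f(1) by (simp add: polys_below_def k)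
    have "?top f = 0\<^sub>v s" using f(1) by (auto simp: polys_below_def ks)
    then have "?ext f = 0\<^sub>v s" using Ac by auto
    then have "galois_inner p l (?W g) (?W f) = 0" if "g \<in> polys_below k" for g
      using f(2) \<open>p > 0\<close> by (simp add: inner[OF fk that] galois_inner_zero_right power_0_left)
    then show "f \<in> {f \<in> polys_below k. \<forall>g\<in>polys_below k. galois_inner p l (?W g) (?W f) = 0}"
      using fk by simp
  next
    fix f assume "f \<in> {f \<in> polys_below k. \<forall>g\<in>polys_below k. galois_inner p l (?W g) (?W f) = 0}"
    then have f: "f \<in> polys_below k"
      and *: "\<And>g. g \<in> polys_below k \<Longrightarrow> galois_inner p l (?W g) (?W f) = 0" by auto
    \<comment> \<open>A polynomial \<open>g\<close> with values \<open>y\<close> on \<open>S\<close>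
      and top coefficients \<open>B *\<^sub>v t\<close> has extension part exactly \<open>t\<close>,
      so \<open>y\<close> and \<open>t\<close> are independent test data for
      \<open>f\<close>.\<close>
    have **: "(\<Sum>i\<in>S. (\<beta> - 1) * w i * (y i * poly f (a $ i) ^ (p ^ l))) +
        galois_inner p l t (?ext f) = 0" if t: "t \<in> carrier_vec s" for y t
    proof -
      obtain g where g: "g \<in> polys_below (card S + h + s)" "\<And>i. i \<in> S \<Longrightarrow> poly g (a $ i) = y i"
        "\<And>j. j < s \<Longrightarrow> Polynomial.coeff g (card S + h + j) = (B *\<^sub>v t) $ j"
        using interpolation_with_top_coeffs[OF fin injS, of "card S + h" s y "\<lambda>j. (B *\<^sub>v t) $ j"]
        by auto
      have "?top g = B *\<^sub>v t" using g(3) B(1) t by (intro eq_vecI) (simp_all add: ks)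
      then have "?ext g = (transpose_mat A * B) *\<^sub>v t"
        using Ac B(1) t by (simp add: assoc_mult_mat_vec[of _ s s _ s])
      then have "?ext g = t" using B(2) t by simp
      then show ?thesis
        using *[of g] inner[OF f, of g] g(1,2) k by simp
    qed
    have "poly f (a $ i) = 0" if i: "i \<in> S" for i
    proof -
      \<comment> \<open>The indicator of \<open>i\<close> together with \<open>t = 0\<close>
        isolates one term, whose coefficient is nonzero because \<open>\<beta> \<noteq> 1\<close>
        and \<open>w i \<noteq> 0\<close>.\<close>
      have "(\<Sum>m\<in>S. (\<beta> - 1) * w m * ((if m = i then 1 else 0) * poly f (a $ m) ^ (p ^ l))) = 0"
        using **[of "0\<^sub>v s" "\<lambda>m. if m = i then 1 else 0"]
        by (simp add: galois_inner_zero_left[OF ext] del: index_mult_mat_vec)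
      also have "(\<Sum>m\<in>S. (\<beta> - 1) * w m * ((if m = i then 1 else 0) * poly f (a $ m) ^ (p ^ l))) =
          (\<Sum>m\<in>S. if m = i then (\<beta> - 1) * w i * poly f (a $ i) ^ (p ^ l) else 0)"
        by (intro sum.cong) auto
      finally show ?thesis using i fin w[of i] S \<open>\<beta> \<noteq> 1\<close> by auto
    qed
    moreover have "f \<in> polys_below (card S + h)"
    proof -
      \<comment> \<open>With \<open>y = 0\<close> and \<open>t\<close> a unit vector, only the
        \<open>p ^ l\<close>-th power of the \<open>j\<close>-th extension coordinate of
        \<open>f\<close> is left.\<close>
      have "?ext f $ j = 0" if "j < s" for j
        using **[of "unit_vec s j" "\<lambda>_. 0"]
        by (simp add: galois_inner_unit_vec_left[OF ext that] del: index_mult_mat_vec)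
      then have "?ext f = 0\<^sub>v s" using ext[of f] Ac
        by (intro eq_vecI) (auto simp del: index_mult_mat_vec)
      then have "(B * transpose_mat A) *\<^sub>v ?top f = 0\<^sub>v s"
        using Ac B(1) by (auto simp: assoc_mult_mat_vec[of _ s s _ s])
      then have top_0: "?top f = 0\<^sub>v s" using B(3) by simp
      have top: "Polynomial.coeff f (card S + h + j) = 0" if "j < s" for j
        using that arg_cong[OF top_0, of "\<lambda>x. x $ j"] by (simp add: ks)
      have "Polynomial.coeff f i = 0" if "i \<ge> card S + h" for i
      proof (cases "i < k")
        case True
        then show ?thesis using top[of "i - (card S + h)"] that k by simp
      qed (use f in \<open>simp add: polys_below_def\<close>)
      then show ?thesis by (simp add: polys_below_def)
    qed
    ultimately show "f \<in> {f \<in> polys_below (card S + h). \<forall>i\<in>S. poly f (a $ i) = 0}" by simp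
  qed
  then show ?thesis unfolding hull by simp
qed

section \<open>Choice of the multipliers and dimension of the hull\<close>

theorem mainTheorem2:
  fixes p e l n \<delta> s k h :: nat
    and a :: "'a :: {finite, field} vec"
    and u :: "nat \<Rightarrow> 'a"
    and lam :: 'a
    and F :: "'a set"
    and A :: "'a mat"
  assumes "prime p"
    and "card (UNIV :: 'a set) = p ^ e"
    and "p ^ e > 4"
    and "l > 0"
    and "2 * l dvd e"
    and "a \<in> carrier_vec n"
    and "inj_on (($) a) {..<n}"
    and "\<And>i. i < n \<Longrightarrow> u i = (\<Prod>j\<in>{..<n} - {i}. inverse (a $ i - a $ j))"
    and "\<delta> > 0"
    and "lam \<noteq> 0"
    and "subfield F (class_ring :: 'a ring)"
    and "card F = p ^ l"
    and "\<And>i. i < n \<Longrightarrow> lam * (a $ i) ^ (\<delta> - 1) * u i \<in> F - {0}"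
    and "s \<ge> 1"
    and "A \<in> general_linear s"
    and "s < k"
    and "int k \<le> \<lfloor>(real n + real p ^ l - real \<delta>) / (real p ^ l + 1)\<rfloor>"
    and "h \<le> k - s"
  shows "\<exists>C. linear_code (n + s) k C \<and> is_GRL_code n s k A C \<and>
             vdim (n + s) (galois_hull p l (n + s) C) = h"
proof -
  define P where "P = p ^ l"
  have "p \<ge> 2" using assms(1) by (rule prime_ge_2_nat)
  then have P: "P \<ge> 2" unfolding P_def using assms(4) self_le_power[of p l] by linarith
  obtain m where m: "e = 2 * l * m" using assms(5) by (elim dvdE)
  have "e > 0" using assms(3) by (intro gr0I) simp
  then have "m > 0" using m by auto
  have q: "p ^ e = (P\<^sup>2) ^ m" unfolding m P_def by (simp add: mult.commute flip: power_mult)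
  \<comment> \<open>The field has at least \<open>P\<^sup>2\<close> elements, and
    \<open>P\<^sup>2\<close> exceeds \<open>P + 2\<close> for \<open>P \<ge> 3\<close>. For
    \<open>P = 2\<close> the two numbers are equal, and the hypothesis \<open>p ^ e > 4\<close>
    supplies the strict inequality.\<close>
  have "P + 2 < p ^ e"
  proof (cases "P = 2")
    case False
    then have "P * 3 \<le> P\<^sup>2" using P unfolding power2_eq_square by (intro mult_left_mono) auto
    then have "P + 2 < P\<^sup>2" using False P by linarith
    also have "\<dots> \<le> p ^ e" unfolding q using \<open>m > 0\<close> P by (intro self_le_power) auto
    finally show ?thesis .
  qed (use assms(3) in simp)
  then have "P + 1 > 0" "card (UNIV :: 'a set) > (P + 1) + 1" unfolding assms(2) by simp_all
  then obtain b :: 'a where b: "b \<noteq> 0" "b ^ (P + 1) \<noteq> 1"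
    by (rule exists_non_root_of_unity)

  have real_bound: "real k * (real P + 1) \<le> real n + real P - real \<delta>"
  proof -
    have "real k \<le> (real n + real P - real \<delta>) / (real P + 1)"
      using assms(17) unfolding P_def by (simp add: le_floor_iff)
    then show ?thesis by (simp add: pos_le_divide_eq)
  qed
  then have "real (k * (P + 1) + \<delta>) \<le> real (n + P)" by (simp add: distrib_left)
  then have bound: "k * (P + 1) + \<delta> \<le> n + P" unfolding of_nat_le_iff .
  have kpos: "k > 0" using assms(16) by simp
  \<comment> \<open>This cancels \<open>P\<close> in \<open>bound\<close> and leaves
    \<open>k + \<delta> \<le> n\<close>.\<close>
  have "P \<le> k * P" using kpos by simp
  then have kn: "k \<le> n" using bound unfolding distrib_left by linarith

  define w where "w i = lam * (a $ i) ^ (\<delta> - 1) * u i" for i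
  have wF: "w i \<in> F - {0}" if "i < n" for i using assms(13)[OF that] by (simp add: w_def)
  have sub: "subring F (class_ring :: 'a ring)"
    using assms(11) unfolding subfield_def subdomain_def subcring_def by blast
  have "x * y \<in> F" if "x \<in> F" "y \<in> F" for x y
    using subringE(6)[OF sub that] by simp
  moreover have "0 \<in> F" using subringE(2)[OF sub] by simp
  then have cardF: "card (F - {0}) = P - 1" using assms(12) by (simp add: P_def)
  \<comment> \<open>The order \<open>P - 1\<close> of the unit group of \<open>F\<close> times the
    exponent \<open>P + 1\<close> must divide \<open>p ^ e - 1\<close>; here
    \<open>2 * l dvd e\<close> enters, through \<open>p ^ e\<close> being a power of
    \<open>P\<^sup>2\<close>.\<close>
  moreover have "(P - 1) * (P + 1) = P\<^sup>2 - 1"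
    using P by (simp add: power2_eq_square algebra_simps diff_mult_distrib)
  then have "(P - 1) * (P + 1) dvd card (UNIV :: 'a set) - 1"
    unfolding assms(2) q by (simp only: minus_one_dvd_power_minus_one)
  ultimately have "\<exists>x. x ^ (P + 1) = w i" if "i < n" for i
    using wF[OF that] by (intro exists_nth_root_finite_field[of "F - {0}"]) auto
  then obtain c where c: "\<And>i. i < n \<Longrightarrow> c i ^ (P + 1) = w i" by metis

  \<comment> \<open>Without modified positions the hull would have dimension \<open>k - s\<close>.
    Each modified position adds one independent vanishing condition, so \<open>r\<close> of them
    leave \<open>h\<close>; the first \<open>r\<close> positions are taken.\<close>
  define r where "r = k - s - h"
  define S where "S = {..<r}"
  have S: "S \<subseteq> {..<n}" "card S = r" using kn by (auto simp: S_def r_def)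
  have k: "k = card S + h + s" using assms(16,18) S(2) by (simp add: r_def)
  define v where "v = vec n (\<lambda>i. if i \<in> S then b * c i else c i)"
  have v: "(v $ i) ^ (P + 1) = (if i \<in> S then b ^ (P + 1) * w i else w i)" if "i < n" for i
    using that c[OF that] by (auto simp: v_def power_mult_distrib simp del: power_Suc)
  have vnz: "v $ i \<noteq> 0" if "i < n" for i
    using v[OF that] wF[OF that] b(1) by (auto split: if_splits)
  have A: "A \<in> carrier_mat s s" using assms(15) by (simp add: general_linear_def)
  note code = linear_code_grl_word[OF assms(6) A assms(7) vnz kn]
  define C where "C = grl_word k a v A ` polys_below k"
  have "linear_code (n + s) k C"
    using code[of 1 k] by (simp add: C_def image_image)
  moreover have "is_GRL_code n s k A C"
    unfolding is_GRL_code_def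
  proof (intro conjI exI)
    show "C = GRL k a v A" by (simp add: C_def GRL_conv_grl_word[OF kpos])
    show "v \<in> carrier_vec n" by (simp add: v_def)
    show "\<forall>i<n. v $ i \<noteq> 0" using vnz by blast
  qed (use assms(6,7,14-16) kn in auto)
  moreover have "vdim (n + s) (galois_hull p l (n + s) C) = h"
  proof -
    let ?q = "\<Prod>i\<in>S. [:- (a $ i), 1:]"
    have fin: "finite S" by (simp add: S_def)
    have injS: "inj_on (($) a) S" using assms(7) S(1) inj_on_subset by blast
    have "galois_hull p l (n + s) C =
        grl_word k a v A ` {f \<in> polys_below (card S + h). \<forall>i\<in>S. poly f (a $ i) = 0}"
      unfolding C_def
    \<comment> \<open>Here \<open>b ^ (P + 1)\<close> takes the role of \<open>\<beta>\<close>, and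
      \<open>orth\<close> is the vanishing of the Lagrange-weighted sums guaranteed by
      \<open>bound\<close>.\<close>
    proof (rule galois_hull_grl_word[OF assms(6,7,15) S(1) k])
      show "p > 0" using \<open>p \<ge> 2\<close> by simp
      show "w i \<noteq> 0" if "i < n" for i using wF[OF that] by simp
      show "b ^ (P + 1) \<noteq> 1" by (rule b(2))
      show "(v $ i) ^ (p ^ l + 1) = (if i \<in> S then b ^ (P + 1) * w i else w i)" if "i < n" for i
        using v[OF that] unfolding P_def .
      show "(\<Sum>i<n. w i * (poly g (a $ i) * poly f (a $ i) ^ (p ^ l))) = 0"
        if "f \<in> polys_below k" "g \<in> polys_below k" for f g
        using sum_lagrange_weights_mult_eq_0[OF assms(7,9) kpos that bound, of lam] assms(8)
        by (simp add: w_def P_def)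
    qed
    also have "\<dots> = grl_word k a v A ` (*) ?q ` polys_below h"
      unfolding polys_vanishing_on[OF fin injS] ..
    finally have eq: "galois_hull p l (n + s) C = grl_word k a v A ` (*) ?q ` polys_below h" .
    have "polys_below (card S + h) \<subseteq> polys_below k" by (auto simp: polys_below_def k)
    then have "(*) ?q ` polys_below h \<subseteq> polys_below k"
      using polys_vanishing_on[OF fin injS, of h] by blast
    then have "linear_code (n + s) h (grl_word k a v A ` (*) ?q ` polys_below h)"
      using fin by (intro code) auto
    then show ?thesis unfolding eq linear_code_def by simp
  qed
  ultimately show ?thesis by blast
qed

end
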